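(* Assume that $\boldsymbol c\in L^1(\Omega,\mathcal A,\mathbb P;\mathbb R^m)$ is integrable and $\boldsymbol c\in-\operatorname{Cone}(A^\top)$ almost surely. Let $x\in\pi(P)$ and let $\sigma$ be a cell of the chamber complex $\mathcal C(P,\pi)$ such that $x\in\operatorname{ri}(\sigma)$. Then for every refinement $\mathcal R$ of $-\mathcal N_\sigma$, $$V(x)=\sum_{R\in\mathcal R}\check p_R\,\hat V(x,\check c_R),\qquad \hat V(x,\check c_R)=\min_{y\in\mathbb R^m}\{\check c_R^\top y \;:\; Ay+Bx\le b\},$$ where $\check p_R:=\mathbb P[\boldsymbol c\in\operatorname{ri}(R)]$, and $\check c_R:=\mathbb E[\boldsymbol c\mid\boldsymbol c\in\operatorname{ri}(R)]$ if $\check p_R>0$ and $\check c_R:=0$ if $\check p_R=0$. In particular, if $\mathcal R$ is a refinement of $\bigwedge_{\sigma\in\mathcal C(P,\pi)}-\mathcal N_\sigma$, the formula for $V(x)$ above holds for all $x\in\pi(P)$.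
   Context: Two-stage setting: $(\Omega,\mathcal A,\mathbb P)$ is a probability space, $A\in\mathbb R^{q\times m}$, $B\in\mathbb R^{q\times n}$, $b\in\mathbb R^q$ are deterministic, $\boldsymbol c$ is a random vector in $\mathbb R^m$. For $x\in\mathbb R^n$, $c\in\mathbb R^m$, $\hat V(x,c):=\min_{y\in\mathbb R^m}\{c^\top y: Ay+Bx\le b\}$ (value in $[-\infty,+\infty]$, equal to $+\infty$ if infeasible) and $V(x):=\mathbb E[\hat V(x,\boldsymbol c)]$. $P:=\{(x,y)\in\mathbb R^n\times\mathbb R^m: Ay+Bx\le b\}$, $\pi(x,y):=x$, and $P_x:=\{y\in\mathbb R^m: Ay+Bx\le b\}$ is the fiber of $P$ at $x$. $\operatorname{Cone}(A^\top):=A^\top\mathbb R^q_+$; $\operatorname{ri}$ is the relative interior. A polyhedral complex is a finite collection $\mathcal C$ of polyhedra such that every non-empty face of an element of $\mathcal C$ is in $\mathcal C$, and the intersection of two elements is a (possibly empty) face of each; its support $\operatorname{supp}\mathcal C$ is the union of its elements. $\mathcal R$ is a refinement of $\mathcal C$ (written $\mathcal R\preceq\mathcal C$) if both are polyhedral complexes with the same support and every cell of $\mathcal R$ is contained in a cell of $\mathcal C$. The common refinement is $\mathcal C\wedge\mathcal C':=\{R\cap R': R\in\mathcal C,R'\in\mathcal C'\}$, and $\bigwedge$ denotes the common refinement of a finite family. The normal cone of a convex set $C$ at $x\in C$ is $N_C(x)=\{\alpha:\alpha^\top(y-x)\le0\ \forall y\in C\}$ and the normal fan is $\mathcal N(C)=\{N_C(x):x\in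 C\}$. Chamber complex: with $\mathcal F(P)$ the set of non-empty faces of $P$ (including $P$), for $x\in\pi(P)$ set $\sigma_{P,\pi}(x):=\bigcap_{F\in\mathcal F(P),\,x\in\pi(F)}\pi(F)$, and $\mathcal C(P,\pi):=\{\sigma_{P,\pi}(x):x\in\pi(P)\}$; it is a polyhedral complex with support $\pi(P)$. It is known that for $\sigma\in\mathcal C(P,\pi)$ the normal fan $\mathcal N(P_x)$ is the same for all $x\in\operatorname{ri}(\sigma)$; this common fan is denoted $\mathcal N_\sigma$, and $-\mathcal N_\sigma:=\{-N:N\in\mathcal N_\sigma\}$. *)

theory Defs
  imports "HOL-Probability.Probability"
begin

text \<open>For polyhedra, \<open>face_of\<close> coincides with \<open>exposed_face_of\<close>
  (\<open>exposed_face_of_polyhedron\<close>). It includes the empty set and the polyhedron itself.\<close>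

definition polyhedral_complex :: "'a::euclidean_space set set \<Rightarrow> bool" where
  "polyhedral_complex \<C> \<longleftrightarrow>
     finite \<C> \<and>
     (\<forall>S\<in>\<C>. polyhedron S) \<and>
     (\<forall>S\<in>\<C>. \<forall>F. F face_of S \<and> F \<noteq> {} \<longrightarrow> F \<in> \<C>) \<and>
     (\<forall>S\<in>\<C>. \<forall>T\<in>\<C>. (S \<inter> T) face_of S \<and> (S \<inter> T) face_of T)"

definition refines :: "'a::euclidean_space set set \<Rightarrow> 'a set set \<Rightarrow> bool" where
  "refines \<R> \<C> \<longleftrightarrow>
     polyhedral_complex \<R> \<and> polyhedral_complex \<C> \<and> \<Union>\<R> = \<Union>\<C> \<and>
     (\<forall>R\<in>\<R>. \<exists>C\<in>\<C>. R \<subseteq> C)"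

definition common_refinement :: "'a set set \<Rightarrow> 'a set set \<Rightarrow> 'a set set" where
  "common_refinement \<C> \<D> = {R \<inter> R' | R R'. R \<in> \<C> \<and> R' \<in> \<D>}"

text \<open>The common refinement of a family intersects one cell from each member; the lemmas below
  show that it is the iteration of the binary operation.\<close>

definition common_refinement_family :: "'i set \<Rightarrow> ('i \<Rightarrow> 'a set set) \<Rightarrow> 'a set set" where
  "common_refinement_family I \<C> = {(\<Inter>i\<in>I. R i) | R. \<forall>i\<in>I. R i \<in> \<C> i}"

lemma common_refinement_family_singleton: "common_refinement_family {i} \<C> = \<C> i"
proof -
  have "\<exists>R. S = R i \<and> R i \<in> \<C> i" if "S \<in> \<C> i" for S
    using that by (intro exI[of _ "\<lambda>_. S"]) simp
  then show ?thesis
    unfolding common_refinement_family_def by (intro equalityI subsetI; simp; blast)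
qed

lemma common_refinement_family_insert:
  assumes "i \<notin> I"
  shows "common_refinement_family (insert i I) \<C> =
         common_refinement (\<C> i) (common_refinement_family I \<C>)"
proof (intro equalityI subsetI)
  fix S assume "S \<in> common_refinement_family (insert i I) \<C>"
  then obtain R where R: "S = (\<Inter>j\<in>insert i I. R j)" "\<forall>j\<in>insert i I. R j \<in> \<C> j"
    unfolding common_refinement_family_def by blast
  have "S = R i \<inter> (\<Inter>j\<in>I. R j)" "R i \<in> \<C> i" "\<forall>j\<in>I. R j \<in> \<C> j"
    using R by simp_all
  then show "S \<in> common_refinement (\<C> i) (common_refinement_family I \<C>)"
    unfolding common_refinement_family_def common_refinement_def by blast
next
  fix S assume "S \<in> common_refinement (\<C> i) (common_refinement_family I \<C>)"
  then obtain S' R where R: "S' \<in> \<C> i" "\<forall>j\<in>I. R j \<in> \<C> j" "S = S' \<inter> (\<Inter>j\<in>I. R j)"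
    unfolding common_refinement_family_def common_refinement_def by blast
  have "(\<Inter>j\<in>I. (R(i := S')) j) = (\<Inter>j\<in>I. R j)"
    using assms by (intro INF_cong) auto
  then have "S = (\<Inter>j\<in>insert i I. (R(i := S')) j)"
    using R(3) by (simp only: INF_insert fun_upd_same)
  moreover have "\<forall>j\<in>insert i I. (R(i := S')) j \<in> \<C> j"
    using R assms by auto
  ultimately show "S \<in> common_refinement_family (insert i I) \<C>"
    unfolding common_refinement_family_def by blast
qed

definition normal_cone :: "'a::real_inner set \<Rightarrow> 'a \<Rightarrow> 'a set" where
  "normal_cone C x = {\<alpha>. \<forall>y\<in>C. \<alpha> \<bullet> (y - x) \<le> 0}"

definition normal_fan :: "'a::real_inner set \<Rightarrow> 'a set set" where
  "normal_fan C = normal_cone C ` C"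

definition chamber :: "'a::real_vector set \<Rightarrow> ('a \<Rightarrow> 'b) \<Rightarrow> 'b \<Rightarrow> 'b set" where
  "chamber P \<pi> x = \<Inter> {\<pi> ` F | F. F face_of P \<and> F \<noteq> {} \<and> x \<in> \<pi> ` F}"

definition chamber_complex :: "'a::real_vector set \<Rightarrow> ('a \<Rightarrow> 'b) \<Rightarrow> 'b set set" where
  "chamber_complex P \<pi> = chamber P \<pi> ` (\<pi> ` P)"

text \<open>Inequalities between vectors are componentwise.\<close>

definition fiber ::
    "real^'m^'q \<Rightarrow> real^'n^'q \<Rightarrow> real^'q \<Rightarrow> real^'n \<Rightarrow> (real^'m) set" where
  "fiber A B b x = {y. A *v y + B *v x \<le> b}"

definition coupling_polyhedron ::
    "real^'m^'q \<Rightarrow> real^'n^'q \<Rightarrow> real^'q \<Rightarrow> ((real^'n) \<times> (real^'m)) set" where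
  "coupling_polyhedron A B b = {(x, y). A *v y + B *v x \<le> b}"

definition matrix_cone :: "real^'q^'m \<Rightarrow> (real^'m) set" where
  "matrix_cone D = {D *v u | u. 0 \<le> u}"

definition recourse_value ::
    "real^'m^'q \<Rightarrow> real^'n^'q \<Rightarrow> real^'q \<Rightarrow> real^'n \<Rightarrow> real^'m \<Rightarrow> ereal" where
  "recourse_value A B b x c = (INF y \<in> fiber A B b x. ereal (c \<bullet> y))"

text \<open>The expectation of an extended real random variable, positive part minus negative part
  (\<open>e2ennreal\<close> maps negative values to \<open>0\<close>).\<close>

definition ereal_expectation :: "'w measure \<Rightarrow> ('w \<Rightarrow> ereal) \<Rightarrow> ereal" where
  "ereal_expectation M f =
     enn2ereal (\<integral>\<^sup>+ \<omega>. e2ennreal (f \<omega>) \<partial>M) - enn2ereal (\<integral>\<^sup>+ \<omega>. e2ennreal (- f \<omega>) \<partial>M)"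

definition expected_recourse ::
    "'w measure \<Rightarrow> real^'m^'q \<Rightarrow> real^'n^'q \<Rightarrow> real^'q \<Rightarrow> ('w \<Rightarrow> real^'m) \<Rightarrow> real^'n \<Rightarrow> ereal" where
  "expected_recourse M A B b c x = ereal_expectation M (\<lambda>\<omega>. recourse_value A B b x (c \<omega>))"

text \<open>\<open>nn_integral\<close> is only a lower integral for non-measurable functions; the integrand above is
  always measurable.\<close>

lemma recourse_value_measurable: "recourse_value A B b x \<in> borel_measurable borel"
proof (rule borel_measurableI_ge)
  fix t :: ereal
  have "closed {c. t \<le> ereal (c \<bullet> y)}" for y :: "real^'m"
    by (intro closed_Collect_le continuous_intros)
  then have "closed (\<Inter>y\<in>fiber A B b x. {c. t \<le> ereal (c \<bullet> y)})"
    by blast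
  also have "(\<Inter>y\<in>fiber A B b x. {c. t \<le> ereal (c \<bullet> y)}) =
      {c \<in> space borel. t \<le> recourse_value A B b x c}"
    by (auto simp: recourse_value_def le_INF_iff)
  finally show "{c \<in> space borel. t \<le> recourse_value A B b x c} \<in> sets borel"
    by (rule borel_closed)
qed

text \<open>The normal fan shared by all fibers over the relative interior of the chamber \<open>\<sigma>\<close>, and its
  reflection at the origin.\<close>

definition chamber_fan ::
    "real^'m^'q \<Rightarrow> real^'n^'q \<Rightarrow> real^'q \<Rightarrow> (real^'n) set \<Rightarrow> (real^'m) set set" where
  "chamber_fan A B b \<sigma> =
     (THE \<N>. \<forall>x\<in>rel_interior \<sigma>. normal_fan (fiber A B b x) = \<N>)"

definition neg_chamber_fan ::
    "real^'m^'q \<Rightarrow> real^'n^'q \<Rightarrow> real^'q \<Rightarrow> (real^'n) set \<Rightarrow> (real^'m) set set" where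
  "neg_chamber_fan A B b \<sigma> = (\<lambda>N. uminus ` N) ` chamber_fan A B b \<sigma>"

definition cell_prob :: "'w measure \<Rightarrow> ('w \<Rightarrow> 'a::euclidean_space) \<Rightarrow> 'a set \<Rightarrow> real" where
  "cell_prob M c R = measure M {\<omega> \<in> space M. c \<omega> \<in> rel_interior R}"

definition cell_mean :: "'w measure \<Rightarrow> ('w \<Rightarrow> 'a::euclidean_space) \<Rightarrow> 'a set \<Rightarrow> 'a" where
  "cell_mean M c R =
     (if cell_prob M c R > 0
      then (LINT \<omega>:{\<omega> \<in> space M. c \<omega> \<in> rel_interior R}|M. c \<omega>) /\<^sub>R cell_prob M c R
      else 0)"

end

theory Submission
  imports Defs
begin

text \<open>Fix \<open>x\<close> in the projection. On the reflected normal cone \<open>- N\<close> of the fiber at a point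
  \<open>y\<close>, the minimum over the fiber is attained at \<open>y\<close>, so the recourse value is the linear
  function \<open>k \<bullet> y\<close> there. A cell \<open>R\<close> of a refinement lies in one such cone, so a single \<open>y\<close>
  serves all of \<open>R\<close>. Expectation commutes with this linear function, and the conditional mean
  inherits the inequalities saying that \<open>y\<close> is a minimizer. Since the relative interiors of the
  cells partition the support of the complex, summing over the cells gives the formula
  (\<open>expected_recourse_cell_sum\<close>), provided that the cells cover \<open>- Cone (A\<^sup>T)\<close>, where the random
  cost lives. The covering is linear programming: a cost in that cone is bounded below on the
  fiber, and a linear function bounded below on a polyhedron attains its minimum
  (\<open>linear_program_attains_minimum\<close>).

  What remains is to relate the fan attached to a chamber \<open>\<sigma>\<close> to the fibers over \<open>ri \<sigma>\<close>.
  A normal cone of a fiber depends only on the set of constraints that are tight at its base point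
  (\<open>normal_cone_fiber\<close>), so it suffices that the fibers over \<open>ri \<sigma>\<close> realize the same tight sets
  (\<open>tight_sets_constant_on_chamber\<close>). Let \<open>\<sigma>\<close> be the chamber of \<open>w\<close>. A tight set realized over
  \<open>w\<close> defines a face of the polyhedron whose projection contains \<open>\<sigma>\<close>, and a convex combination
  realizes the same tight set over each point of \<open>ri \<sigma>\<close> (\<open>tight_set_transfer\<close>). For the
  converse, let \<open>I\<close> be a tight set realized over \<open>x \<in> ri \<sigma>\<close>. The sum \<open>\<alpha>\<close> of the rows in \<open>I\<close> is
  maximal over the fiber at \<open>x\<close> exactly where all of \<open>I\<close> is tight. A maximizer of \<open>\<alpha>\<close> over the
  fiber at \<open>w\<close> shares its tight set with a point over \<open>x\<close>, which then also maximizes \<open>\<alpha>\<close>; so \<open>I\<close>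
  is tight at both. Hence the face cut out by \<open>I\<close> lies over \<open>w\<close>, and the transfer also works from
  \<open>x\<close> to \<open>w\<close>. This uses that \<open>w\<close> lies in \<open>ri \<sigma>\<close> (\<open>mem_rel_interior_chamber\<close>). The same fact
  assigns to every point of the projection a chamber with that point in its relative interior,
  which reduces the statement about the common refinement to a single chamber.\<close>

section \<open>Relative interiors of cells\<close>

text \<open>Take an inclusion-minimal member containing \<open>z\<close>: outside its relative interior, \<open>z\<close> would
  lie on a facet, which is a smaller member.\<close>

lemma exists_rel_interior_cell:
  fixes \<C> :: "'a::euclidean_space set set"
  assumes "finite \<C>" and "\<And>S. S \<in> \<C> \<Longrightarrow> polyhedron S"
    and faces: "\<And>S F. S \<in> \<C> \<Longrightarrow> F face_of S \<Longrightarrow> F \<noteq> {} \<Longrightarrow> F \<in> \<C>"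
    and "z \<in> \<Union>\<C>"
  shows "\<exists>S\<in>\<C>. z \<in> rel_interior S"
proof -
  have "finite {S \<in> \<C>. z \<in> S}" "{S \<in> \<C>. z \<in> S} \<noteq> {}"
    using assms by auto
  then obtain S where S: "S \<in> \<C>" "z \<in> S"
    and minimal: "\<And>T. T \<in> \<C> \<Longrightarrow> z \<in> T \<Longrightarrow> T \<subseteq> S \<Longrightarrow> T = S"
    using finite_has_minimal[of "{S \<in> \<C>. z \<in> S}"] by auto
  have "z \<in> rel_interior S"
  proof (rule ccontr)
    assume "z \<notin> rel_interior S"
    then have "z \<in> \<Union>{F. F facet_of S}"
      using S rel_boundary_of_polyhedron[OF assms(2)[OF S(1)]] by blast
    then obtain F where F: "F facet_of S" "z \<in> F" by blast
    have "F \<in> \<C>"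
      using F(2) by (intro faces[OF S(1) facet_of_imp_face_of[OF F(1)]]) auto
    moreover have "F \<subseteq> S" using F(1) by (rule facet_of_imp_subset)
    ultimately have "F = S" using minimal F(2) by blast
    then show False using F(1) by (simp add: facet_of_irrefl)
  qed
  then show ?thesis using S by blast
qed

lemma polyhedral_complex_rel_interior_cell:
  assumes "polyhedral_complex \<C>" and "z \<in> \<Union>\<C>"
  shows "\<exists>S\<in>\<C>. z \<in> rel_interior S"
  using assms by (intro exists_rel_interior_cell) (auto simp: polyhedral_complex_def)

text \<open>The common face of the two cells meets the relative interior of each, so it is all of each.\<close>

lemma polyhedral_complex_rel_interior_unique:
  assumes "polyhedral_complex \<C>" and "S \<in> \<C>" "T \<in> \<C>"
    and "z \<in> rel_interior S" "z \<in> rel_interior T"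
  shows "S = T"
proof -
  have face: "(S \<inter> T) face_of S" "(S \<inter> T) face_of T"
    using assms unfolding polyhedral_complex_def by blast+
  have "z \<in> S \<inter> T" using assms rel_interior_subset by blast
  then have "S \<subseteq> S \<inter> T"
    using assms(4) by (intro subset_of_face_of[OF face(1)]) auto
  moreover have "T \<subseteq> S \<inter> T"
    using \<open>z \<in> S \<inter> T\<close> assms(5) by (intro subset_of_face_of[OF face(2)]) auto
  ultimately show ?thesis by blast
qed

lemma mem_rel_interior_face:
  fixes P :: "'a::euclidean_space set"
  assumes "polyhedron P" and "p \<in> P"
  shows "\<exists>F. F face_of P \<and> p \<in> rel_interior F"
proof -
  have "\<exists>F\<in>{F. F face_of P}. p \<in> rel_interior F"
  proof (rule exists_rel_interior_cell)
    show "finite {F. F face_of P}"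
      using assms(1) by (rule finite_polyhedron_faces)
    show "polyhedron F" if "F \<in> {F. F face_of P}" for F
      using that assms(1) face_of_polyhedron_polyhedron by auto
    show "G \<in> {F. F face_of P}" if "F \<in> {F. F face_of P}" "G face_of F" for F G
      using that face_of_trans by auto
    have "P face_of P" using assms(1) by (simp add: face_of_refl polyhedron_imp_convex)
    then show "p \<in> \<Union>{F. F face_of P}" using assms(2) by auto
  qed
  then show ?thesis by blast
qed

lemma Union_common_refinement_family_supset:
  assumes "\<And>i. i \<in> I \<Longrightarrow> K \<subseteq> \<Union>(\<C> i)"
  shows "K \<subseteq> \<Union>(common_refinement_family I \<C>)"
proof
  fix k assume "k \<in> K"
  then have "\<forall>i\<in>I. \<exists>S. S \<in> \<C> i \<and> k \<in> S" using assms by blast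
  then obtain S where "\<forall>i\<in>I. S i \<in> \<C> i \<and> k \<in> S i"
    unfolding bchoice_iff by (elim exE)
  then have "(\<Inter>i\<in>I. S i) \<in> common_refinement_family I \<C>" "k \<in> (\<Inter>i\<in>I. S i)"
    unfolding common_refinement_family_def by auto
  then show "k \<in> \<Union>(common_refinement_family I \<C>)" by (rule UnionI)
qed

lemma common_refinement_family_cell_subset:
  assumes "S \<in> common_refinement_family I \<C>" and "i \<in> I"
  shows "\<exists>C\<in>\<C> i. S \<subseteq> C"
  using assms unfolding common_refinement_family_def by auto

section \<open>Attainment and normal cones for systems of linear inequalities\<close>

definition tight_rows :: "real^'m^'q \<Rightarrow> real^'q \<Rightarrow> real^'m \<Rightarrow> 'q set" where
  "tight_rows A r y = {i. (A *v y) $ i = r $ i}"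

lemma fiber_iff: "y \<in> fiber A B b x \<longleftrightarrow> A *v y \<le> b - B *v x"
  by (simp add: fiber_def le_diff_eq)

text \<open>Only the tight rows constrain an infinitesimal move; the others have room to spare.\<close>

lemma small_step_feasible:
  fixes A :: "real^'m^'q"
  assumes y: "A *v y \<le> r" and d: "\<And>i. i \<in> tight_rows A r y \<Longrightarrow> (A *v d) $ i \<le> 0"
  shows "\<exists>\<epsilon>>0. A *v (y + \<epsilon> *\<^sub>R d) \<le> r"
proof -
  have "\<forall>\<^sub>F \<epsilon> in at_right 0. (A *v y) $ i + \<epsilon> * (A *v d) $ i \<le> r $ i" for i
  proof (cases "i \<in> tight_rows A r y")
    case True
    then have "(A *v y) $ i = r $ i" "(A *v d) $ i \<le> 0"
      using d by (auto simp: tight_rows_def)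
    then show ?thesis
      by (auto intro!: eventually_mono[OF eventually_at_right_less[of "0::real"]]
          simp: mult_nonneg_nonpos)
  next
    case False
    then have "(A *v y) $ i + 0 * (A *v d) $ i < r $ i"
      using y by (auto simp: less_eq_vec_def tight_rows_def less_le)
    moreover have "((\<lambda>\<epsilon>. (A *v y) $ i + \<epsilon> * (A *v d) $ i) \<longlongrightarrow>
        (A *v y) $ i + 0 * (A *v d) $ i) (at_right 0)"
      by (intro tendsto_intros)
    ultimately have "\<forall>\<^sub>F \<epsilon> in at_right 0. (A *v y) $ i + \<epsilon> * (A *v d) $ i < r $ i"
      by (rule order_tendstoD(2)[rotated])
    then show ?thesis
      by (rule eventually_mono) simp
  qed
  then have "\<forall>\<^sub>F \<epsilon> in at_right (0::real). \<forall>i. (A *v y) $ i + \<epsilon> * (A *v d) $ i \<le> r $ i"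
    by (rule eventually_all_finite)
  then have "\<forall>\<^sub>F \<epsilon> in at_right (0::real).
      \<epsilon> > 0 \<and> (\<forall>i. (A *v y) $ i + \<epsilon> * (A *v d) $ i \<le> r $ i)"
    using eventually_at_right_less[of "0::real"] by (simp add: eventually_conj_iff)
  then obtain \<epsilon> :: real where "\<epsilon> > 0" "\<forall>i. (A *v y) $ i + \<epsilon> * (A *v d) $ i \<le> r $ i"
    using eventually_happens trivial_limit_at_right_real by blast
  then show ?thesis
    by (intro exI[of _ \<epsilon>])
      (simp add: less_eq_vec_def matrix_vector_right_distrib matrix_vector_mult_scaleR)
qed

text \<open>The directions into the polyhedron at \<open>y\<close> are, up to scaling, those that do not increase the
  tight rows. The normal cone is the polar of these directions, so it depends on \<open>y\<close> through the
  tight rows alone.\<close>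

lemma normal_cone_tight_rows:
  fixes A :: "real^'m^'q"
  assumes y: "A *v y \<le> r"
  shows "normal_cone {z. A *v z \<le> r} y =
    {\<alpha>. \<forall>d. (\<forall>i\<in>tight_rows A r y. (A *v d) $ i \<le> 0) \<longrightarrow> \<alpha> \<bullet> d \<le> 0}" (is "_ = ?N")
proof (intro equalityI subsetI)
  fix \<alpha> assume \<alpha>: "\<alpha> \<in> normal_cone {z. A *v z \<le> r} y"
  show "\<alpha> \<in> ?N"
  proof (intro CollectI allI impI)
    fix d assume "\<forall>i\<in>tight_rows A r y. (A *v d) $ i \<le> 0"
    then obtain \<epsilon> where "\<epsilon> > 0" "A *v (y + \<epsilon> *\<^sub>R d) \<le> r"
      using small_step_feasible[OF y, of d] by blast
    then have "\<alpha> \<bullet> (\<epsilon> *\<^sub>R d) \<le> 0"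
      using \<alpha> by (fastforce simp: normal_cone_def)
    then show "\<alpha> \<bullet> d \<le> 0"
      using \<open>\<epsilon> > 0\<close> by (simp add: mult_le_0_iff)
  qed
next
  fix \<alpha> assume \<alpha>: "\<alpha> \<in> ?N"
  have "\<alpha> \<bullet> (z - y) \<le> 0" if "A *v z \<le> r" for z
    using \<alpha> that
    by (auto simp: tight_rows_def less_eq_vec_def matrix_vector_mult_diff_distrib)
  then show "\<alpha> \<in> normal_cone {z. A *v z \<le> r} y"
    by (simp add: normal_cone_def)
qed

text \<open>Along a descent direction that preserves the tight rows, boundedness of the objective prevents
  the ray from staying feasible forever; at its exit point a further row becomes tight.\<close>

lemma push_to_new_tight_row:
  fixes A :: "real^'m^'q"
  assumes y: "A *v y \<le> r" and bound: "\<And>z. A *v z \<le> r \<Longrightarrow> m \<le> c \<bullet> z"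
    and d: "\<And>i. i \<in> tight_rows A r y \<Longrightarrow> (A *v d) $ i = 0" and descent: "c \<bullet> d < 0"
  shows "\<exists>z. A *v z \<le> r \<and> tight_rows A r y \<subset> tight_rows A r z \<and> c \<bullet> z \<le> c \<bullet> y"
proof -
  let ?J = "{j. (A *v d) $ j > 0}"
  let ?t = "\<lambda>j. (r $ j - (A *v y) $ j) / (A *v d) $ j"
  have y': "(A *v y) $ i \<le> r $ i" for i
    using y by (simp add: less_eq_vec_def)
  have ray: "(A *v (y + t *\<^sub>R d)) $ i = (A *v y) $ i + t * (A *v d) $ i" for t i
    by (simp add: matrix_vector_right_distrib matrix_vector_mult_scaleR)
  have "?J \<noteq> {}"
  proof
    assume "?J = {}"
    then have nonpos: "(A *v d) $ i \<le> 0" for i by (simp add: not_less)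
    \<comment> \<open>This step length brings the objective to \<open>m - 1\<close>, below the bound.\<close>
    define t where "t = (c \<bullet> y - m + 1) / (- (c \<bullet> d))"
    have "t \<ge> 0" using bound[OF y] descent unfolding t_def by (intro divide_nonneg_pos) auto
    then have "(A *v (y + t *\<^sub>R d)) $ i \<le> r $ i" for i
      using y'[of i] mult_nonneg_nonpos[OF \<open>t \<ge> 0\<close> nonpos[of i]] unfolding ray by linarith
    then have "m \<le> c \<bullet> (y + t *\<^sub>R d)"
      by (intro bound) (simp add: less_eq_vec_def)
    moreover have "t * (c \<bullet> d) = - (c \<bullet> y - m + 1)"
      using descent by (simp add: t_def)
    ultimately show False by (simp add: inner_add_right)
  qed
  then obtain j where j: "j \<in> ?J" "\<And>i. i \<in> ?J \<Longrightarrow> ?t j \<le> ?t i"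
    using ex_is_arg_min_if_finite[of ?J ?t] by (auto simp: is_arg_min_linorder)
  define z where "z = y + ?t j *\<^sub>R d"
  have t0: "?t j \<ge> 0" using j(1) y'[of j] by simp
  have "(A *v z) $ i \<le> r $ i" for i
  proof (cases "i \<in> ?J")
    case True
    then have "?t j * (A *v d) $ i \<le> ?t i * (A *v d) $ i"
      using j(2) by (intro mult_right_mono) auto
    with True show ?thesis unfolding z_def ray by simp
  next
    case False
    then have "?t j * (A *v d) $ i \<le> 0"
      using t0 by (intro mult_nonneg_nonpos) auto
    with y'[of i] show ?thesis unfolding z_def ray by linarith
  qed
  moreover have "tight_rows A r y \<subseteq> tight_rows A r z"
    using d unfolding z_def by (auto simp: tight_rows_def ray)
  moreover have "j \<in> tight_rows A r z" "j \<notin> tight_rows A r y"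
    using j(1) d[of j] unfolding z_def by (auto simp: tight_rows_def ray)
  moreover have "c \<bullet> z \<le> c \<bullet> y"
    using mult_nonneg_nonpos[OF t0, of "c \<bullet> d"] descent by (simp add: z_def inner_add_right)
  ultimately show ?thesis
    by (intro exI[of _ z]) (auto simp: less_eq_vec_def)
qed

text \<open>Pushing along descent directions until none preserves the tight rows leads from any feasible
  point to a \<open>stuck\<close> point with no larger objective. At a stuck point the objective is determined by
  the tight rows, so only finitely many values occur, and the least of them is the minimum.\<close>

lemma linear_program_attains_minimum:
  fixes A :: "real^'m^'q"
  assumes y: "A *v y \<le> r" and bound: "\<And>z. A *v z \<le> r \<Longrightarrow> m \<le> c \<bullet> z"
  shows "\<exists>y. A *v y \<le> r \<and> (\<forall>z. A *v z \<le> r \<longrightarrow> c \<bullet> y \<le> c \<bullet> z)"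
proof -
  define stuck where
    "stuck z \<longleftrightarrow> A *v z \<le> r \<and> (\<forall>d. (\<forall>i\<in>tight_rows A r z. (A *v d) $ i = 0) \<longrightarrow> c \<bullet> d = 0)" for z
  have reach: "\<exists>w. stuck w \<and> c \<bullet> w \<le> c \<bullet> z" if "A *v z \<le> r" for z
    using that
  proof (induction "card (- tight_rows A r z)" arbitrary: z rule: less_induct)
    case less
    show ?case
    proof (cases "stuck z")
      case False
      then obtain d where d: "\<And>i. i \<in> tight_rows A r z \<Longrightarrow> (A *v d) $ i = 0" "c \<bullet> d \<noteq> 0"
        using less.prems by (auto simp: stuck_def)
      define d' where "d' = (if c \<bullet> d < 0 then d else - d)"
      have "c \<bullet> d' < 0" "\<And>i. i \<in> tight_rows A r z \<Longrightarrow> (A *v d') $ i = 0"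
        using d by (auto simp: d'_def matrix_vector_mult_scaleR[of A "-1" d, simplified])
      then obtain w where w: "A *v w \<le> r" "tight_rows A r z \<subset> tight_rows A r w" "c \<bullet> w \<le> c \<bullet> z"
        using push_to_new_tight_row[OF less.prems bound, of d'] by blast
      then have "card (- tight_rows A r w) < card (- tight_rows A r z)"
        by (intro psubset_card_mono) auto
      then show ?thesis
        using less.hyps w by fastforce
    qed auto
  qed
  have "finite ((\<bullet>) c ` Collect stuck)"
  proof -
    have same: "c \<bullet> z = c \<bullet> w" if "stuck z" "stuck w" "tight_rows A r z = tight_rows A r w" for z w
    proof -
      have "\<forall>i\<in>tight_rows A r z. (A *v (z - w)) $ i = 0"
        using that(3) by (auto simp: tight_rows_def matrix_vector_mult_diff_distrib)
      then have "c \<bullet> (z - w) = 0" using that(1) by (simp add: stuck_def)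
      then show ?thesis by (simp add: inner_diff_right)
    qed
    let ?pick = "\<lambda>I. SOME z. stuck z \<and> tight_rows A r z = I"
    have "c \<bullet> z = c \<bullet> ?pick (tight_rows A r z)" if "stuck z" for z
      using someI[of "\<lambda>w. stuck w \<and> tight_rows A r w = tight_rows A r z" z] same that by metis
    then have "(\<bullet>) c ` Collect stuck \<subseteq> (\<lambda>I. c \<bullet> ?pick I) ` UNIV"
      by blast
    then show ?thesis by (rule finite_subset) simp
  qed
  moreover have "Collect stuck \<noteq> {}" using reach[OF y] by blast
  ultimately have "Min ((\<bullet>) c ` Collect stuck) \<in> (\<bullet>) c ` Collect stuck"
    and least: "\<And>z. stuck z \<Longrightarrow> Min ((\<bullet>) c ` Collect stuck) \<le> c \<bullet> z"
    by (auto intro!: Min_in Min_le)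
  then obtain w where w: "stuck w" "\<And>z. stuck z \<Longrightarrow> c \<bullet> w \<le> c \<bullet> z"
    by auto
  then have "c \<bullet> w \<le> c \<bullet> z" if "A *v z \<le> r" for z
    using reach[OF that] by force
  then show ?thesis using w(1) stuck_def by blast
qed

text \<open>Weak duality: if \<open>c = - A\<^sup>T u\<close> with \<open>u \<ge> 0\<close>, then \<open>c \<bullet> y = - u \<bullet> A y\<close> is at least
  \<open>- u \<bullet> (b - B x)\<close> on the fiber. A minimizer therefore exists, and its normal cone contains \<open>- c\<close>.\<close>

lemma dual_feasible_cost_in_neg_normal_cone:
  fixes A :: "real^'m^'q"
  assumes c: "c \<in> uminus ` matrix_cone (transpose A)" and "fiber A B b x \<noteq> {}"
  shows "\<exists>y\<in>fiber A B b x. c \<in> uminus ` normal_cone (fiber A B b x) y"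
proof -
  obtain u where u: "c = - (transpose A *v u)" "0 \<le> u"
    using c by (auto simp: matrix_cone_def)
  define r where "r = b - B *v x"
  have "- (u \<bullet> r) \<le> c \<bullet> z" if "A *v z \<le> r" for z
  proof -
    have "u \<bullet> (A *v z) \<le> u \<bullet> r"
      using that u(2) unfolding inner_vec_def
      by (intro sum_mono) (auto simp: less_eq_vec_def intro: mult_left_mono)
    then show ?thesis by (simp add: u(1) dot_lmul_matrix)
  qed
  moreover obtain y0 where "A *v y0 \<le> r"
    using assms(2) by (auto simp: fiber_iff r_def)
  ultimately obtain y where y: "A *v y \<le> r" "\<And>z. A *v z \<le> r \<Longrightarrow> c \<bullet> y \<le> c \<bullet> z"
    using linear_program_attains_minimum by metis
  have "- c \<in> normal_cone (fiber A B b x) y"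
    using y(2) by (auto simp: normal_cone_def fiber_iff r_def inner_diff_right)
  then have "c \<in> uminus ` normal_cone (fiber A B b x) y"
    by (intro image_eqI[of _ _ "- c"]) simp_all
  moreover have "y \<in> fiber A B b x" using y(1) by (simp add: fiber_iff r_def)
  ultimately show ?thesis by blast
qed

section \<open>Tight sets of constraints in the coupling polyhedron\<close>

definition tight_at :: "real^'m^'q \<Rightarrow> real^'n^'q \<Rightarrow> real^'q \<Rightarrow> real^'n \<Rightarrow> real^'m \<Rightarrow> 'q set" where
  "tight_at A B b x y = {i. (A *v y + B *v x) $ i = b $ i}"

abbreviation tight_face ::
    "real^'m^'q \<Rightarrow> real^'n^'q \<Rightarrow> real^'q \<Rightarrow> 'q set \<Rightarrow> ((real^'n) \<times> (real^'m)) set" where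
  "tight_face A B b I \<equiv> {(x, y). y \<in> fiber A B b x \<and> I \<subseteq> tight_at A B b x y}"

lemma normal_cone_fiber:
  assumes "y \<in> fiber A B b x"
  shows "normal_cone (fiber A B b x) y =
    {\<alpha>. \<forall>d. (\<forall>i\<in>tight_at A B b x y. (A *v d) $ i \<le> 0) \<longrightarrow> \<alpha> \<bullet> d \<le> 0}"
proof -
  have "fiber A B b x = {z. A *v z \<le> b - B *v x}"
    by (auto simp: fiber_iff)
  moreover have "tight_rows A (b - B *v x) y = tight_at A B b x y"
    by (auto simp: tight_rows_def tight_at_def)
  ultimately show ?thesis
    using normal_cone_tight_rows[of A y "b - B *v x"] assms by (simp add: fiber_iff)
qed

lemma polyhedron_coupling: "polyhedron (coupling_polyhedron A B b)"
proof -
  have "coupling_polyhedron A B b = (\<Inter>i. {p. (B $ i, A $ i) \<bullet> p \<le> b $ i})"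
    by (auto simp: coupling_polyhedron_def less_eq_vec_def matrix_mult_dot add.commute)
  moreover have "polyhedron (\<Inter>i. {p. (B $ i, A $ i) \<bullet> p \<le> b $ i})"
    by (intro polyhedron_Inter) (auto simp: polyhedron_halfspace_le)
  ultimately show ?thesis by simp
qed

lemma fst_coupling_polyhedron_iff: "x \<in> fst ` coupling_polyhedron A B b \<longleftrightarrow> fiber A B b x \<noteq> {}"
  unfolding coupling_polyhedron_def fiber_def image_iff Bex_def by auto

text \<open>Each tight row cuts the polyhedron in a supporting hyperplane. The polyhedron itself is
  included in the intersection of these faces to allow \<open>I = {}\<close>.\<close>

lemma tight_face_face_of: "tight_face A B b I face_of coupling_polyhedron A B b"
proof -
  let ?P = "coupling_polyhedron A B b"
  define h where "h i = {p. (B $ i, A $ i) \<bullet> p = b $ i}" for i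
  have P: "convex ?P" by (simp add: polyhedron_imp_convex polyhedron_coupling)
  have "(B $ i, A $ i) \<bullet> p \<le> b $ i" if "p \<in> ?P" for i p
    using that by (cases p)
      (simp add: coupling_polyhedron_def less_eq_vec_def matrix_mult_dot add.commute)
  then have "(?P \<inter> h i) face_of ?P" for i
    unfolding h_def by (intro face_of_Int_supporting_hyperplane_le P)
  then have "\<Inter>(insert ?P ((\<lambda>i. ?P \<inter> h i) ` I)) face_of ?P"
    using P by (intro face_of_Inter) (auto simp: face_of_refl)
  moreover have "p \<in> \<Inter>(insert ?P ((\<lambda>i. ?P \<inter> h i) ` I)) \<longleftrightarrow> p \<in> tight_face A B b I" for p
    by (cases p) (auto simp: h_def coupling_polyhedron_def fiber_def tight_at_def
        matrix_mult_dot add.commute)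
  then have "\<Inter>(insert ?P ((\<lambda>i. ?P \<inter> h i) ` I)) = tight_face A B b I"
    by blast
  ultimately show ?thesis by simp
qed

section \<open>Chambers\<close>

text \<open>Each face over \<open>x\<close> may be shrunk to the face having a lift of \<open>x\<close> in its relative interior, and
  linear images preserve relative interiors. So the chamber is a finite intersection of convex sets
  that all have \<open>x\<close> in their relative interior, and relative interiors commute with such
  intersections.\<close>

lemma
  fixes P :: "('a::euclidean_space \<times> 'b::euclidean_space) set"
  assumes P: "polyhedron P" and x: "x \<in> fst ` P"
  shows convex_chamber: "convex (chamber P fst x)"
    and mem_rel_interior_chamber: "x \<in> rel_interior (chamber P fst x)"
proof -
  let ?\<F> = "{fst ` F | F. F face_of P \<and> F \<noteq> {} \<and> x \<in> fst ` F}"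
  let ?\<G> = "{fst ` F | F. F face_of P \<and> x \<in> rel_interior (fst ` F)}"
  have image: "fst ` rel_interior F = rel_interior (fst ` F)" if "F face_of P" for F
    using that by (intro rel_interior_convex_linear_image linear_fst face_of_imp_convex)
  have refine: "\<exists>G\<in>?\<G>. G \<subseteq> fst ` F" if F: "F face_of P" "x \<in> fst ` F" for F
  proof -
    obtain p where p: "p \<in> F" "x = fst p" using F by blast
    obtain G where G: "G face_of F" "p \<in> rel_interior G"
      using mem_rel_interior_face[OF face_of_polyhedron_polyhedron[OF P F(1)] p(1)] by blast
    have "G face_of P" using G(1) F(1) by (rule face_of_trans)
    moreover have "G \<subseteq> F" using G(1) by (rule face_of_imp_subset)
    moreover have "x \<in> rel_interior (fst ` G)"
      using image[OF \<open>G face_of P\<close>] G(2) p(2) by auto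
    ultimately show ?thesis by (intro bexI[of _ "fst ` G"]) auto
  qed
  have eq: "chamber P fst x = \<Inter>?\<G>"
    unfolding chamber_def
  proof (intro equalityI Inter_greatest)
    fix S assume "S \<in> ?\<G>"
    then obtain F where F: "S = fst ` F" "F face_of P" "x \<in> rel_interior (fst ` F)" by auto
    then have "x \<in> fst ` F" using rel_interior_subset by (auto dest: subsetD)
    then have "S \<in> ?\<F>" using F(1,2) by auto
    then show "\<Inter>?\<F> \<subseteq> S" by (rule Inter_lower)
  next
    fix S assume "S \<in> ?\<F>"
    then obtain F where F: "S = fst ` F" "F face_of P" "x \<in> fst ` F" by auto
    then obtain G where "G \<in> ?\<G>" "G \<subseteq> S" using refine[OF F(2,3)] unfolding F(1) by (elim bexE)
    then show "\<Inter>?\<G> \<subseteq> S" by (intro order_trans[OF Inter_lower])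
  qed
  have convex: "convex S" if "S \<in> ?\<G>" for S
    using that by (auto intro!: convex_linear_image[OF linear_fst] dest: face_of_imp_convex)
  then show "convex (chamber P fst x)"
    unfolding eq by (rule convex_Inter)
  have "finite {F. F face_of P}" using P by (rule finite_polyhedron_faces)
  then have "finite ((`) fst ` {F. F face_of P})" by simp
  then have "finite ?\<G>" by (rule rev_finite_subset) blast
  moreover have x\<G>: "x \<in> \<Inter>(rel_interior ` ?\<G>)" by auto
  then have "\<Inter>(rel_interior ` ?\<G>) \<noteq> {}" by auto
  ultimately have "rel_interior (\<Inter>?\<G>) = \<Inter>(rel_interior ` ?\<G>)"
    by (intro convex_rel_interior_finite_Inter convex)
  then show "x \<in> rel_interior (chamber P fst x)"
    unfolding eq using x\<G> by (simp only:)
qed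

lemma chamber_subset_tight_face:
  assumes "y \<in> fiber A B b x" and "I \<subseteq> tight_at A B b x y"
  shows "chamber (coupling_polyhedron A B b) fst x \<subseteq> fst ` tight_face A B b I"
proof -
  have xy: "(x, y) \<in> tight_face A B b I" using assms by simp
  show ?thesis
    unfolding chamber_def
  proof (intro Inter_lower CollectI exI conjI)
    show "tight_face A B b I face_of coupling_polyhedron A B b" by (rule tight_face_face_of)
    show "x \<in> fst ` tight_face A B b I" using xy by (intro image_eqI[of _ _ "(x, y)"]) simp_all
    then show "tight_face A B b I \<noteq> {}" by auto
  qed simp
qed

text \<open>Prolong the segment from \<open>w\<close> through \<open>x\<close> slightly to a point \<open>w'\<close> of \<open>S\<close>, and choose over
  \<open>w'\<close> a point whose tight set is at least that of \<open>v\<close>. In a proper convex combination a slack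
  vanishes only if both end slacks do, so exactly the tight set of \<open>v\<close> survives over \<open>x\<close>.\<close>

lemma tight_set_transfer:
  fixes A :: "real^'m^'q"
  assumes S: "convex S" "x \<in> rel_interior S" "w \<in> S"
    and v: "v \<in> fiber A B b w"
    and cover: "S \<subseteq> fst ` tight_face A B b (tight_at A B b w v)"
  shows "\<exists>y\<in>fiber A B b x. tight_at A B b x y = tight_at A B b w v"
proof -
  obtain e where e: "e > 1" "(1 - e) *\<^sub>R w + e *\<^sub>R x \<in> S"
    using convex_rel_interior_iff[OF S(1), of x] S(2,3) by auto
  define w' where "w' = (1 - e) *\<^sub>R w + e *\<^sub>R x"
  obtain v' where v': "v' \<in> fiber A B b w'" "tight_at A B b w v \<subseteq> tight_at A B b w' v'"
    using subsetD[OF cover, of w'] e(2) unfolding w'_def[symmetric] by auto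
  define t where "t = 1 / e"
  have t: "0 < t" "t < 1" using e(1) by (simp_all add: t_def)
  have x: "x = (1 - t) *\<^sub>R w + t *\<^sub>R w'"
    using e(1) by (simp add: w'_def t_def algebra_simps)
  define y where "y = (1 - t) *\<^sub>R v + t *\<^sub>R v'"
  \<comment> \<open>The slack of row \<open>i\<close> at \<open>(p, q)\<close>, an affine function of the pair.\<close>
  define g where "g p q i = b $ i - (A *v q + B *v p) $ i" for p q i
  have g: "g x y i = (1 - t) * g w v i + t * g w' v' i" for i
    by (simp add: x y_def g_def matrix_vector_right_distrib matrix_vector_mult_scaleR algebra_simps)
  have fiber: "q \<in> fiber A B b p \<longleftrightarrow> (\<forall>i. g p q i \<ge> 0)" for p q
    by (simp add: fiber_def less_eq_vec_def g_def)
  have tight: "i \<in> tight_at A B b p q \<longleftrightarrow> g p q i = 0" for p q i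
    by (auto simp: tight_at_def g_def)
  have nonneg: "g w v i \<ge> 0" "g w' v' i \<ge> 0" for i
    using v v'(1) fiber by blast+
  have "y \<in> fiber A B b x"
    using t nonneg by (simp add: fiber g)
  moreover have "g x y i = 0 \<longleftrightarrow> g w v i = 0" for i
  proof -
    have "g w v i = 0 \<Longrightarrow> g w' v' i = 0" using v'(2) tight by blast
    moreover have "(1 - t) * g w v i + t * g w' v' i > 0" if "g w v i \<noteq> 0"
      using t nonneg[of i] that by (intro add_pos_nonneg mult_pos_pos) auto
    ultimately show ?thesis unfolding g by fastforce
  qed
  then have "tight_at A B b x y = tight_at A B b w v"
    using tight by blast
  ultimately show ?thesis by blast
qed

text \<open>The chamber is defined through the faces over \<open>w\<close>, which gives the inclusion from \<open>w\<close> to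
  \<open>x\<close>. For the other inclusion it must be shown that the face cut out by the tight set \<open>I\<close> of a point
  over \<open>x\<close> also lies over \<open>w\<close>. The witness maximizes the sum \<open>\<alpha>\<close> of the rows in \<open>I\<close> over the
  fiber at \<open>w\<close>: by the first inclusion its tight set, hence its normal cone, also occurs over \<open>x\<close>,
  where the maximum of \<open>\<alpha>\<close> forces all of \<open>I\<close> to be tight.\<close>

lemma tight_sets_constant_on_chamber:
  fixes A :: "real^'m^'q"
  assumes w: "w \<in> fst ` coupling_polyhedron A B b"
    and x: "x \<in> rel_interior (chamber (coupling_polyhedron A B b) fst w)"
  shows "tight_at A B b x ` fiber A B b x = tight_at A B b w ` fiber A B b w"
proof -
  let ?S = "chamber (coupling_polyhedron A B b) fst w"
  note chamber = convex_chamber[OF polyhedron_coupling w]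
    mem_rel_interior_chamber[OF polyhedron_coupling w]
  have inS: "x \<in> ?S" "w \<in> ?S" using x chamber(2) rel_interior_subset by blast+
  have down: "\<exists>y\<in>fiber A B b x. tight_at A B b x y = tight_at A B b w v"
    if "v \<in> fiber A B b w" for v
    using tight_set_transfer[OF chamber(1) x inS(2) that
        chamber_subset_tight_face[OF that order_refl]] .
  have up: "\<exists>v\<in>fiber A B b w. tight_at A B b w v = tight_at A B b x y"
    if y: "y \<in> fiber A B b x" for y
  proof -
    let ?I = "tight_at A B b x y"
    define u :: "real^'q" where "u = (\<chi> i. if i \<in> ?I then 1 else 0)"
    define \<alpha> where "\<alpha> = transpose A *v u"
    have "0 \<le> u" by (simp add: u_def less_eq_vec_def)
    then have "- \<alpha> \<in> uminus ` matrix_cone (transpose A)"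
      by (auto simp: \<alpha>_def matrix_cone_def)
    then obtain v where v: "v \<in> fiber A B b w" "\<alpha> \<in> normal_cone (fiber A B b w) v"
      using dual_feasible_cost_in_neg_normal_cone[of "- \<alpha>" A B b w] w
      by (auto simp: fst_coupling_polyhedron_iff)
    obtain z where z: "z \<in> fiber A B b x" "tight_at A B b x z = tight_at A B b w v"
      using down[OF v(1)] by blast
    have "\<alpha> \<in> normal_cone (fiber A B b x) z"
      using v z by (simp add: normal_cone_fiber)
    then have "\<alpha> \<bullet> (y - z) \<le> 0"
      using y by (simp add: normal_cone_def)
    moreover have "\<alpha> \<bullet> (y - z) = u \<bullet> (A *v (y - z))"
      by (simp add: \<alpha>_def dot_lmul_matrix)
    moreover have "\<dots> = (\<Sum>i\<in>?I. (A *v (y - z)) $ i)"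
      by (simp add: inner_vec_def u_def if_distrib[of "\<lambda>t. t * _"] sum.If_cases cong: if_cong)
    \<comment> \<open>Every row in \<open>I\<close> is already at its bound at \<open>y\<close>, so each summand is nonnegative.\<close>
    moreover have gap: "(A *v (y - z)) $ i \<ge> 0" if "i \<in> ?I" for i
      using that z(1)
      by (simp add: tight_at_def fiber_def less_eq_vec_def matrix_vector_mult_diff_distrib)
        (metis add_le_cancel_right)
    ultimately have "(\<Sum>i\<in>?I. (A *v (y - z)) $ i) = 0"
      by (simp add: sum_nonneg antisym)
    then have "(A *v (y - z)) $ i = 0" if "i \<in> ?I" for i
      using gap that by (subst (asm) sum_nonneg_eq_0_iff) auto
    then have "?I \<subseteq> tight_at A B b x z"
      by (auto simp: tight_at_def matrix_vector_mult_diff_distrib)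
    then have "?I \<subseteq> tight_at A B b w v" using z(2) by simp
    then show ?thesis
      using tight_set_transfer[OF chamber inS(1) y chamber_subset_tight_face[OF v(1)]] by simp
  qed
  show ?thesis using down up by (auto simp: image_iff) metis+
qed

lemma normal_fan_determined_by_tight_sets:
  assumes "tight_at A B b x ` fiber A B b x = tight_at A B b w ` fiber A B b w"
  shows "normal_fan (fiber A B b x) = normal_fan (fiber A B b w)"
proof -
  define K where "K I = {\<alpha>. \<forall>d. (\<forall>i\<in>I. (A *v d) $ i \<le> 0) \<longrightarrow> \<alpha> \<bullet> d \<le> 0}" for I
  have "normal_fan (fiber A B b z) = K ` tight_at A B b z ` fiber A B b z" for z
    unfolding normal_fan_def image_image K_def by (intro image_cong refl normal_cone_fiber)
  then show ?thesis using assms by simp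
qed

lemma neg_normal_fan_covers_dual_cone:
  fixes A :: "real^'m^'q"
  assumes "fiber A B b x \<noteq> {}"
  shows "uminus ` matrix_cone (transpose A) \<subseteq>
    \<Union>((\<lambda>N. uminus ` N) ` normal_fan (fiber A B b x))"
  using dual_feasible_cost_in_neg_normal_cone[OF _ assms] by (auto simp: normal_fan_def)

text \<open>Constancy of the normal fan over \<open>ri \<sigma>\<close>, together with a point \<open>x\<close> of \<open>ri \<sigma>\<close>, makes the
  definite description in \<open>chamber_fan\<close> well defined.\<close>

lemma neg_chamber_fan_eq:
  assumes \<sigma>: "\<sigma> \<in> chamber_complex (coupling_polyhedron A B b) fst" and x: "x \<in> rel_interior \<sigma>"
  shows "neg_chamber_fan A B b \<sigma> = (\<lambda>N. uminus ` N) ` normal_fan (fiber A B b x)"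
proof -
  obtain w where w: "w \<in> fst ` coupling_polyhedron A B b"
    "\<sigma> = chamber (coupling_polyhedron A B b) fst w"
    using \<sigma> by (auto simp: chamber_complex_def)
  have const: "normal_fan (fiber A B b z) = normal_fan (fiber A B b w)" if "z \<in> rel_interior \<sigma>" for z
    using that w tight_sets_constant_on_chamber
    by (intro normal_fan_determined_by_tight_sets) blast
  have "chamber_fan A B b \<sigma> = normal_fan (fiber A B b x)"
    unfolding chamber_fan_def using const x by (intro the_equality) metis+
  then show ?thesis by (simp add: neg_chamber_fan_def)
qed

section \<open>Expectation over the cells\<close>

lemma ereal_expectation_eq_integral:
  fixes g :: "'w \<Rightarrow> real"
  assumes g: "integrable M g" and f: "AE \<omega> in M. f \<omega> = ereal (g \<omega>)"
  shows "ereal_expectation M f = ereal (LINT \<omega>|M. g \<omega>)"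
proof -
  have "(\<integral>\<^sup>+\<omega>. e2ennreal (f \<omega>) \<partial>M) = (\<integral>\<^sup>+\<omega>. ennreal (g \<omega>) \<partial>M)"
    "(\<integral>\<^sup>+\<omega>. e2ennreal (- f \<omega>) \<partial>M) = (\<integral>\<^sup>+\<omega>. ennreal (- g \<omega>) \<partial>M)"
    using f by (auto intro!: nn_integral_cong_AE elim!: eventually_mono)
  moreover obtain p n where "p \<ge> 0" "n \<ge> 0" "(\<integral>\<^sup>+\<omega>. ennreal (g \<omega>) \<partial>M) = ennreal p"
    "(\<integral>\<^sup>+\<omega>. ennreal (- g \<omega>) \<partial>M) = ennreal n"
    using g unfolding real_integrable_def by (metis ennreal_cases infinity_ennreal_def)
  ultimately show ?thesis
    using real_lebesgue_integral_def[OF g] by (simp add: ereal_expectation_def enn2ereal_ennreal)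
qed

text \<open>The relative frontier is closed.\<close>

lemma rel_interior_closed_measurable:
  fixes S :: "'a::euclidean_space set"
  assumes "closed S"
  shows "rel_interior S \<in> sets borel"
proof -
  have "rel_interior S = S - rel_frontier S"
    using assms rel_interior_subset[of S] by (auto simp: rel_frontier_def)
  then show ?thesis using assms by (simp add: borel_closed)
qed

text \<open>In the null case the mean is the default value \<open>0\<close> and the integrand vanishes almost surely,
  so multiplying by the probability makes the identity hold for every cell.\<close>

lemma cell_prob_mult_inner_cell_mean:
  fixes c :: "'w \<Rightarrow> 'a::euclidean_space"
  assumes "prob_space M" and c: "integrable M c" and R: "polyhedron R"
  shows "integrable M (\<lambda>\<omega>. indicator (rel_interior R) (c \<omega>) * (c \<omega> \<bullet> v))"
    and "cell_prob M c R * (cell_mean M c R \<bullet> v) =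
      (LINT \<omega>|M. indicator (rel_interior R) (c \<omega>) * (c \<omega> \<bullet> v))"
proof -
  interpret prob_space M by fact
  define E where "E = {\<omega> \<in> space M. c \<omega> \<in> rel_interior R}"
  have E: "E \<in> sets M"
    using measurable_sets[OF borel_measurable_integrable[OF c]
        rel_interior_closed_measurable[OF polyhedron_imp_closed[OF R]]]
    by (simp add: E_def vimage_def Int_def conj_commute)
  have ind: "indicator (rel_interior R) (c \<omega>) = (indicator E \<omega> :: real)" if "\<omega> \<in> space M" for \<omega>
    using that by (simp add: E_def indicator_def)
  have int: "integrable M (\<lambda>\<omega>. indicator E \<omega> *\<^sub>R c \<omega>)"
    using E c by (intro integrable_mult_indicator)
  have cong: "indicator (rel_interior R) (c \<omega>) * (c \<omega> \<bullet> v) = (indicator E \<omega> *\<^sub>R c \<omega>) \<bullet> v"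
    if "\<omega> \<in> space M" for \<omega>
    using ind[OF that] by simp
  show "integrable M (\<lambda>\<omega>. indicator (rel_interior R) (c \<omega>) * (c \<omega> \<bullet> v))"
    using integrable_inner_left[OF int, of v]
    by (subst Bochner_Integration.integrable_cong[OF refl cong]) simp_all
  have "(LINT \<omega>|M. indicator (rel_interior R) (c \<omega>) * (c \<omega> \<bullet> v)) =
      (LINT \<omega>|M. indicator E \<omega> *\<^sub>R c \<omega>) \<bullet> v"
    using integral_inner_left[OF int, of v]
    by (subst Bochner_Integration.integral_cong[OF refl cong]) simp_all
  also have "\<dots> = cell_prob M c R * (cell_mean M c R \<bullet> v)"
  proof (cases "cell_prob M c R > 0")
    case True
    then show ?thesis
      by (simp add: cell_mean_def set_lebesgue_integral_def E_def)
  next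
    case False
    then have "measure M E = 0"
      by (simp add: cell_prob_def E_def not_less measure_le_0_iff)
    then have "AE \<omega> in M. \<omega> \<notin> E"
      using E by (simp add: AE_iff_measurable emeasure_eq_measure AE_not_in null_setsI)
    then have "AE \<omega> in M. indicator E \<omega> *\<^sub>R c \<omega> = 0"
      by eventually_elim simp
    then have "(LINT \<omega>|M. indicator E \<omega> *\<^sub>R c \<omega>) = 0"
      by (rule integral_eq_zero_AE)
    then show ?thesis using False by (simp add: cell_mean_def)
  qed
  finally show "cell_prob M c R * (cell_mean M c R \<bullet> v) =
      (LINT \<omega>|M. indicator (rel_interior R) (c \<omega>) * (c \<omega> \<bullet> v))" by simp
qed

lemma recourse_value_eq_minimum:
  assumes "y \<in> fiber A B b x" and "\<And>z. z \<in> fiber A B b x \<Longrightarrow> k \<bullet> y \<le> k \<bullet> z"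
  shows "recourse_value A B b x k = ereal (k \<bullet> y)"
  unfolding recourse_value_def using assms by (intro antisym INF_lower INF_greatest) auto

text \<open>With a common minimizer \<open>Y R\<close> for all costs in \<open>R\<close>, the recourse value agrees on the support
  with the piecewise linear function \<open>g\<close>, because each point of the support lies in the relative
  interior of exactly one cell. The inequalities expressing optimality of \<open>Y R\<close> are linear in the
  cost and survive averaging over the cell; the zero cost assigned to a null cell is minimized by every point.\<close>

lemma expected_recourse_cell_sum:
  fixes A :: "real^'m^'q" and c :: "'w \<Rightarrow> real^'m"
  assumes M: "prob_space M" and c: "integrable M c"
    and cone: "AE \<omega> in M. c \<omega> \<in> uminus ` matrix_cone (transpose A)"
    and \<R>: "polyhedral_complex \<R>"
    and optimal: "\<And>R. R \<in> \<R> \<Longrightarrow> \<exists>y\<in>fiber A B b x. R \<subseteq> uminus ` normal_cone (fiber A B b x) y"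
    and cover: "uminus ` matrix_cone (transpose A) \<subseteq> \<Union>\<R>"
  shows "expected_recourse M A B b c x =
      (\<Sum>R\<in>\<R>. ereal (cell_prob M c R) * recourse_value A B b x (cell_mean M c R))"
    and "\<forall>R\<in>\<R>. \<exists>y. is_arg_min (\<lambda>y. cell_mean M c R \<bullet> y) (\<lambda>y. y \<in> fiber A B b x) y \<and>
      recourse_value A B b x (cell_mean M c R) = ereal (cell_mean M c R \<bullet> y)"
proof -
  interpret prob_space M by fact
  have fin: "finite \<R>" and poly: "R \<in> \<R> \<Longrightarrow> polyhedron R" for R
    using \<R> by (auto simp: polyhedral_complex_def)
  have "\<forall>R\<in>\<R>. \<exists>y. y \<in> fiber A B b x \<and> R \<subseteq> uminus ` normal_cone (fiber A B b x) y"
    using optimal unfolding Bex_def by (intro ballI)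
  then obtain Y where Y: "\<And>R. R \<in> \<R> \<Longrightarrow> Y R \<in> fiber A B b x"
    "\<And>R. R \<in> \<R> \<Longrightarrow> R \<subseteq> uminus ` normal_cone (fiber A B b x) (Y R)"
    unfolding bchoice_iff by auto
  have cell_opt: "k \<bullet> Y R \<le> k \<bullet> z" if "R \<in> \<R>" "k \<in> R" "z \<in> fiber A B b x" for R k z
    using subsetD[OF Y(2)[OF that(1)] that(2)] that(3)
    by (auto simp: normal_cone_def inner_diff_right)
  have mean_opt: "cell_mean M c R \<bullet> Y R \<le> cell_mean M c R \<bullet> z"
    if "R \<in> \<R>" "z \<in> fiber A B b x" for R z
  proof (cases "cell_prob M c R > 0")
    case True
    have "0 \<le> indicator (rel_interior R) k * (k \<bullet> (z - Y R))" for k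
      using cell_opt[OF that(1) _ that(2)] rel_interior_subset[of R]
      by (auto simp: indicator_def inner_diff_right)
    then have "0 \<le> cell_prob M c R * (cell_mean M c R \<bullet> (z - Y R))"
      unfolding cell_prob_mult_inner_cell_mean(2)[OF M c poly[OF that(1)]]
      by (intro Bochner_Integration.integral_nonneg)
    then show ?thesis using True by (simp add: zero_le_mult_iff inner_diff_right)
  next
    case False
    then show ?thesis by (simp add: cell_mean_def)
  qed
  have mean_value: "recourse_value A B b x (cell_mean M c R) = ereal (cell_mean M c R \<bullet> Y R)"
    if "R \<in> \<R>" for R
    using that Y(1) mean_opt by (intro recourse_value_eq_minimum)
  show "\<forall>R\<in>\<R>. \<exists>y. is_arg_min (\<lambda>y. cell_mean M c R \<bullet> y) (\<lambda>y. y \<in> fiber A B b x) y \<and>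
      recourse_value A B b x (cell_mean M c R) = ereal (cell_mean M c R \<bullet> y)"
  proof
    fix R assume "R \<in> \<R>"
    then show "\<exists>y. is_arg_min (\<lambda>y. cell_mean M c R \<bullet> y) (\<lambda>y. y \<in> fiber A B b x) y \<and>
        recourse_value A B b x (cell_mean M c R) = ereal (cell_mean M c R \<bullet> y)"
      using Y(1) mean_opt mean_value by (intro exI[of _ "Y R"]) (simp add: is_arg_min_linorder)
  qed
  define g where "g k = (\<Sum>R\<in>\<R>. indicator (rel_interior R) k * (k \<bullet> Y R))" for k
  have point_value: "recourse_value A B b x k = ereal (g k)" if k: "k \<in> \<Union>\<R>" for k
  proof -
    obtain R where R: "R \<in> \<R>" "k \<in> rel_interior R"
      using polyhedral_complex_rel_interior_cell[OF \<R> k] by auto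
    have other: "k \<notin> rel_interior S" if "S \<in> \<R> - {R}" for S
      using that polyhedral_complex_rel_interior_unique[OF \<R> _ R(1) _ R(2), of S] by auto
    have "g k = indicator (rel_interior R) k * (k \<bullet> Y R) +
        (\<Sum>S\<in>\<R> - {R}. indicator (rel_interior S) k * (k \<bullet> Y S))"
      unfolding g_def using fin R(1) by (rule sum.remove)
    also have "\<dots> = k \<bullet> Y R" using R(2) other by simp
    finally have "g k = k \<bullet> Y R" .
    moreover have "k \<in> R" using rel_interior_subset R(2) by (rule subsetD)
    then have "recourse_value A B b x k = ereal (k \<bullet> Y R)"
      by (intro recourse_value_eq_minimum Y(1) cell_opt R(1))
    ultimately show ?thesis by simp
  qed
  note cell = cell_prob_mult_inner_cell_mean[OF M c poly]
  have int: "integrable M (\<lambda>\<omega>. g (c \<omega>))"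
    unfolding g_def using cell(1) by (rule Bochner_Integration.integrable_sum)
  have "AE \<omega> in M. recourse_value A B b x (c \<omega>) = ereal (g (c \<omega>))"
    using cone
  proof eventually_elim
    case (elim \<omega>)
    show ?case using subsetD[OF cover elim] by (rule point_value)
  qed
  then have "expected_recourse M A B b c x = ereal (LINT \<omega>|M. g (c \<omega>))"
    unfolding expected_recourse_def by (rule ereal_expectation_eq_integral[OF int])
  also have "(LINT \<omega>|M. g (c \<omega>)) =
      (\<Sum>R\<in>\<R>. LINT \<omega>|M. indicator (rel_interior R) (c \<omega>) * (c \<omega> \<bullet> Y R))"
    unfolding g_def using cell(1) by (rule Bochner_Integration.integral_sum)
  also have "\<dots> = (\<Sum>R\<in>\<R>. cell_prob M c R * (cell_mean M c R \<bullet> Y R))"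
    by (intro sum.cong refl cell(2)[symmetric])
  also have "ereal \<dots> = (\<Sum>R\<in>\<R>. ereal (cell_prob M c R * (cell_mean M c R \<bullet> Y R)))"
    by (rule sum_ereal[symmetric])
  also have "\<dots> = (\<Sum>R\<in>\<R>. ereal (cell_prob M c R) * recourse_value A B b x (cell_mean M c R))"
    by (intro sum.cong refl) (simp add: mean_value)
  finally show "expected_recourse M A B b c x =
      (\<Sum>R\<in>\<R>. ereal (cell_prob M c R) * recourse_value A B b x (cell_mean M c R))" .
qed

text \<open>A cell of a refinement of the common refinement lies, in particular, in a reflected normal cone
  of the chamber having \<open>x\<close> in its relative interior.\<close>

theorem theorem9:
  fixes M :: "'w measure"
    and A :: "real^'m^'q" and B :: "real^'n^'q" and b :: "real^'q"
    and c :: "'w \<Rightarrow> real^'m"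
  assumes "prob_space M"
    and "integrable M c"
    and "AE \<omega> in M. c \<omega> \<in> uminus ` matrix_cone (transpose A)"
  shows "(\<forall>x \<sigma>. x \<in> fst ` coupling_polyhedron A B b \<longrightarrow>
            \<sigma> \<in> chamber_complex (coupling_polyhedron A B b) fst \<longrightarrow>
            x \<in> rel_interior \<sigma> \<longrightarrow>
            (\<forall>\<R>. refines \<R> (neg_chamber_fan A B b \<sigma>) \<longrightarrow>
               expected_recourse M A B b c x =
                 (\<Sum>R\<in>\<R>. ereal (cell_prob M c R) * recourse_value A B b x (cell_mean M c R)) \<and>
               (\<forall>R\<in>\<R>. \<exists>y. is_arg_min (\<lambda>y. cell_mean M c R \<bullet> y) (\<lambda>y. y \<in> fiber A B b x) y \<and>
                  recourse_value A B b x (cell_mean M c R) = ereal (cell_mean M c R \<bullet> y)))) \<and>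
         (\<forall>\<R>. refines \<R> (common_refinement_family
                  (chamber_complex (coupling_polyhedron A B b) fst) (neg_chamber_fan A B b)) \<longrightarrow>
            (\<forall>x \<in> fst ` coupling_polyhedron A B b.
               expected_recourse M A B b c x =
                 (\<Sum>R\<in>\<R>. ereal (cell_prob M c R) * recourse_value A B b x (cell_mean M c R)) \<and>
               (\<forall>R\<in>\<R>. \<exists>y. is_arg_min (\<lambda>y. cell_mean M c R \<bullet> y) (\<lambda>y. y \<in> fiber A B b x) y \<and>
                  recourse_value A B b x (cell_mean M c R) = ereal (cell_mean M c R \<bullet> y))))"
proof (intro conjI)
  let ?P = "coupling_polyhedron A B b"
  let ?formula = "\<lambda>x \<R>. expected_recourse M A B b c x =
        (\<Sum>R\<in>\<R>. ereal (cell_prob M c R) * recourse_value A B b x (cell_mean M c R)) \<and>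
      (\<forall>R\<in>\<R>. \<exists>y. is_arg_min (\<lambda>y. cell_mean M c R \<bullet> y) (\<lambda>y. y \<in> fiber A B b x) y \<and>
        recourse_value A B b x (cell_mean M c R) = ereal (cell_mean M c R \<bullet> y))"
  have covered: "uminus ` matrix_cone (transpose A) \<subseteq> \<Union>(neg_chamber_fan A B b \<sigma>)"
    if \<sigma>: "\<sigma> \<in> chamber_complex ?P fst" for \<sigma>
  proof -
    obtain w where w: "w \<in> fst ` ?P" "\<sigma> = chamber ?P fst w"
      using \<sigma> by (auto simp: chamber_complex_def)
    have "neg_chamber_fan A B b \<sigma> = (\<lambda>N. uminus ` N) ` normal_fan (fiber A B b w)"
      using mem_rel_interior_chamber[OF polyhedron_coupling w(1)] w(2)
      by (intro neg_chamber_fan_eq[OF \<sigma>]) simp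
    then show ?thesis
      using neg_normal_fan_covers_dual_cone[of A B b w] w(1)
      by (simp add: fst_coupling_polyhedron_iff)
  qed
  have optimal: "\<exists>y\<in>fiber A B b x. R \<subseteq> uminus ` normal_cone (fiber A B b x) y"
    if \<sigma>: "\<sigma> \<in> chamber_complex ?P fst" "x \<in> rel_interior \<sigma>" and C: "C \<in> neg_chamber_fan A B b \<sigma>" "R \<subseteq> C"
    for x \<sigma> C R
  proof -
    obtain y where "y \<in> fiber A B b x" "C = uminus ` normal_cone (fiber A B b x) y"
      using C(1) unfolding neg_chamber_fan_eq[OF \<sigma>] normal_fan_def image_image
      by (elim imageE)
    then show ?thesis using C(2) by (intro bexI[of _ y]) simp_all
  qed
  show "\<forall>x \<sigma>. x \<in> fst ` ?P \<longrightarrow> \<sigma> \<in> chamber_complex ?P fst \<longrightarrow> x \<in> rel_interior \<sigma> \<longrightarrow>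
      (\<forall>\<R>. refines \<R> (neg_chamber_fan A B b \<sigma>) \<longrightarrow> ?formula x \<R>)"
  proof (intro allI impI)
    fix x \<sigma> \<R>
    assume "x \<in> fst ` ?P" and \<sigma>: "\<sigma> \<in> chamber_complex ?P fst" "x \<in> rel_interior \<sigma>"
      and \<R>: "refines \<R> (neg_chamber_fan A B b \<sigma>)"
    have cells: "\<exists>y\<in>fiber A B b x. R \<subseteq> uminus ` normal_cone (fiber A B b x) y"
      if R: "R \<in> \<R>" for R
    proof -
      obtain C where "C \<in> neg_chamber_fan A B b \<sigma>" "R \<subseteq> C"
        using \<R> R unfolding refines_def by auto
      then show ?thesis by (rule optimal[OF \<sigma>])
    qed
    have cover: "uminus ` matrix_cone (transpose A) \<subseteq> \<Union>\<R>"
      using \<R> covered[OF \<sigma>(1)] unfolding refines_def by simp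
    have complex: "polyhedral_complex \<R>" using \<R> unfolding refines_def by simp
    show "?formula x \<R>"
      by (intro conjI expected_recourse_cell_sum[OF assms complex cells cover])
  qed
  show "\<forall>\<R>. refines \<R> (common_refinement_family (chamber_complex ?P fst) (neg_chamber_fan A B b)) \<longrightarrow>
      (\<forall>x\<in>fst ` ?P. ?formula x \<R>)"
  proof (intro allI impI ballI)
    fix \<R> x
    assume \<R>: "refines \<R> (common_refinement_family (chamber_complex ?P fst) (neg_chamber_fan A B b))"
      and x: "x \<in> fst ` ?P"
    define \<sigma> where "\<sigma> = chamber ?P fst x"
    have \<sigma>: "\<sigma> \<in> chamber_complex ?P fst" "x \<in> rel_interior \<sigma>"
      using x mem_rel_interior_chamber[OF polyhedron_coupling x]
      by (simp_all add: \<sigma>_def chamber_complex_def)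
    have cells: "\<exists>y\<in>fiber A B b x. R \<subseteq> uminus ` normal_cone (fiber A B b x) y"
      if R: "R \<in> \<R>" for R
    proof -
      obtain S where S: "S \<in> common_refinement_family (chamber_complex ?P fst) (neg_chamber_fan A B b)"
        "R \<subseteq> S"
        using \<R> R unfolding refines_def by auto
      obtain C where "C \<in> neg_chamber_fan A B b \<sigma>" "S \<subseteq> C"
        using common_refinement_family_cell_subset[OF S(1) \<sigma>(1)] by auto
      then show ?thesis using S(2) by (intro optimal[OF \<sigma>, of C R]) simp_all
    qed
    have cover: "uminus ` matrix_cone (transpose A) \<subseteq> \<Union>\<R>"
      using \<R> Union_common_refinement_family_supset[OF covered] unfolding refines_def by simp
    have complex: "polyhedral_complex \<R>" using \<R> unfolding refines_def by simp
    show "?formula x \<R>"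
      by (intro conjI expected_recourse_cell_sum[OF assms complex cells cover])
  qed
qed

end
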